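(* Let $\Sigma$ be a valued monoid, let $M,M'$ be $\Sigma$-contracting spaces with central points both denoted $\omega$, and let $h_1,h_2:M\to M'$ be two $\Sigma$-homogeneous maps which are tangent at $\omega$. Then $h_1=h_2$.
   Context: Write $\mathbb R_+=[0,+\infty[$. Tangency: for metric spaces $M,M'$ and $a\in M$, two maps $f,g:M\to M'$ are tangent at $a$ if $\forall\varepsilon>0\ \exists\eta>0\ \forall x\in M\ (d(x,a)\le\eta\Rightarrow d(f(x),g(x))\le\varepsilon\, d(x,a))$. A valued monoid is a (multiplicatively written) monoid $\Sigma$ with an absorbing element $0$ (i.e. $t\cdot 0=0$ for each $t\in\Sigma$), equipped with a monoid homomorphism $v:\Sigma\to\mathbb R_+$ (multiplicative monoid), called the valuation, such that (1) for all $t\in\Sigma$, $v(t)=0\iff t=0$; (2) there exists $t\in\Sigma$ with $0<v(t)<1$. A $\Sigma$-contracting space is a metric space $M$ with a chosen point $\omega\in M$ (the central point) and an external operation $\Sigma\times M\to M$, $(t,x)\mapsto t\star x$, such that $1\star x=x$; $t'\star(t\star x)=(t'\cdot t)\star x$; $0\star\omega=\omega$; and $d(t\star x,t\star y)=v(t)\,d(x,y)$, for all $t,t'\in\Sigma$, $x,y\in M$. A map $h:M\to M'$ between $\Sigma$-contracting spaces is $\Sigma$-homogeneous if $h(t\star x)=t\star h(x)$ for all $t\in\Sigma$, $x\in M$. *)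

theory Defs
  imports "HOL-Analysis.Analysis"
begin

definition tangent_at :: "('a::metric_space \<Rightarrow> 'b::metric_space) \<Rightarrow> ('a \<Rightarrow> 'b) \<Rightarrow> 'a \<Rightarrow> bool" where
  "tangent_at f g a \<longleftrightarrow>
    (\<forall>\<epsilon>>0. \<exists>\<eta>>0. \<forall>x. dist x a \<le> \<eta> \<longrightarrow> dist (f x) (g x) \<le> \<epsilon> * dist x a)"

text \<open>
  The monoid need not be commutative.  Only \<open>t * 0 = 0\<close> is assumed of \<open>0\<close>; the law
  \<open>0 * t = 0\<close> follows from multiplicativity of the valuation and \<open>v_eq_0_iff\<close>.
\<close>

locale valued_monoid =
  fixes v :: "'s::{monoid_mult,zero} \<Rightarrow> real"
  assumes absorbing: "t * 0 = (0::'s)"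
    and v_nonneg: "0 \<le> v t"
    and v_one: "v 1 = 1"
    and v_mult: "v (s * t) = v s * v t"
    and v_eq_0_iff: "v t = 0 \<longleftrightarrow> t = 0"
    and ex_contracting: "\<exists>t. 0 < v t \<and> v t < 1"

locale contracting_space = valued_monoid v
  for v :: "'s::{monoid_mult,zero} \<Rightarrow> real" +
  fixes act :: "'s \<Rightarrow> 'a::metric_space \<Rightarrow> 'a"
    and \<omega> :: 'a
  assumes act_one: "act 1 x = x"
    and act_act: "act t' (act t x) = act (t' * t) x"
    and act_zero_centre: "act 0 \<omega> = \<omega>"
    and dist_act: "dist (act t x) (act t y) = v t * dist x y"

definition homogeneous :: "('s \<Rightarrow> 'a \<Rightarrow> 'a) \<Rightarrow> ('s \<Rightarrow> 'b \<Rightarrow> 'b) \<Rightarrow> ('a \<Rightarrow> 'b) \<Rightarrow> bool" where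
  "homogeneous act act' h \<longleftrightarrow> (\<forall>t x. h (act t x) = act' t (h x))"

end

theory Submission
  imports Defs
begin

text \<open>Replacing \<open>x\<close> by \<open>act s x\<close> multiplies both the distance
  between the images of \<open>x\<close> and the distance from \<open>x\<close> to the centre by
  \<open>v s\<close>: the former by homogeneity, the latter by \<open>dist_act_centre\<close>.
  Hence, when \<open>v s > 0\<close>, the tangency inequality for a given \<epsilon> holds at
  \<open>x\<close> as soon as it holds at \<open>act s x\<close>. Powers of a contracting element
  bring any point close enough to the centre (\<open>ex_act_near_centre\<close>), so the local
  inequality becomes global. Letting \<epsilon> tend to 0 makes the images equal.\<close>

lemma (in valued_monoid) v_power: "v (t ^ n) = v t ^ n"
  by (induction n) (simp_all add: v_one v_mult)

text \<open>Write the centre as \<open>act 0 \<omega>\<close> and absorb \<open>t\<close> through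
  \<open>t * 0 = 0\<close>.\<close>

lemma (in contracting_space) act_centre: "act t \<omega> = \<omega>"
  by (metis act_zero_centre act_act absorbing)

lemma (in contracting_space) dist_act_centre: "dist (act t x) \<omega> = v t * dist x \<omega>"
  by (metis act_centre dist_act)

lemma (in contracting_space) ex_act_near_centre:
  assumes "0 < \<eta>"
  shows "\<exists>s. 0 < v s \<and> dist (act s x) \<omega> \<le> \<eta>"
proof -
  obtain t where t: "0 < v t" "v t < 1"
    using ex_contracting by blast
  \<comment> \<open>Adding 1 keeps the divisor below positive even when \<open>x\<close> is the
    centre.\<close>
  have pos: "0 < dist x \<omega> + 1"
    by (smt (verit) zero_le_dist)
  then obtain n where "v t ^ n < \<eta> / (dist x \<omega> + 1)"
    using real_arch_pow_inv[of "\<eta> / (dist x \<omega> + 1)" "v t"] t assms by auto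
  then have n: "v t ^ n * (dist x \<omega> + 1) < \<eta>"
    using pos by (simp add: pos_less_divide_eq)
  have "v t ^ n * dist x \<omega> \<le> v t ^ n * (dist x \<omega> + 1)"
    using t by (intro mult_left_mono) auto
  with n have "dist (act (t ^ n) x) \<omega> \<le> \<eta>"
    by (simp add: dist_act_centre v_power)
  moreover have "0 < v (t ^ n)"
    using t by (simp add: v_power)
  ultimately show ?thesis
    by blast
qed

theorem theorem2p1p19:
  fixes v :: "'s::{monoid_mult,zero} \<Rightarrow> real"
    and act :: "'s \<Rightarrow> 'a::metric_space \<Rightarrow> 'a" and \<omega> :: 'a
    and act' :: "'s \<Rightarrow> 'b::metric_space \<Rightarrow> 'b" and \<omega>' :: 'b
    and h\<^sub>1 h\<^sub>2 :: "'a \<Rightarrow> 'b"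
  assumes "valued_monoid v"
    and "contracting_space v act \<omega>"
    and "contracting_space v act' \<omega>'"
    and "homogeneous act act' h\<^sub>1"
    and "homogeneous act act' h\<^sub>2"
    and "tangent_at h\<^sub>1 h\<^sub>2 \<omega>"
  shows "h\<^sub>1 = h\<^sub>2"
proof
  fix x
  interpret M: contracting_space v act \<omega> by fact
  interpret M': contracting_space v act' \<omega>' by fact
  have bound: "dist (h\<^sub>1 x) (h\<^sub>2 x) \<le> \<epsilon> * dist x \<omega>" if eps: "0 < \<epsilon>" for \<epsilon>
  proof -
    obtain \<eta> where "0 < \<eta>"
      and \<eta>: "\<And>y. dist y \<omega> \<le> \<eta> \<Longrightarrow> dist (h\<^sub>1 y) (h\<^sub>2 y) \<le> \<epsilon> * dist y \<omega>"
      using \<open>tangent_at h\<^sub>1 h\<^sub>2 \<omega>\<close> eps unfolding tangent_at_def by blast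
    obtain s where s: "0 < v s" "dist (act s x) \<omega> \<le> \<eta>"
      using M.ex_act_near_centre[OF \<open>0 < \<eta>\<close>] by blast
    \<comment> \<open>Tangency is applied at \<open>act s x\<close>; the common factor
      \<open>v s > 0\<close> then cancels.\<close>
    have "v s * dist (h\<^sub>1 x) (h\<^sub>2 x) = dist (h\<^sub>1 (act s x)) (h\<^sub>2 (act s x))"
      using assms(4,5) by (simp add: homogeneous_def M'.dist_act)
    also have "\<dots> \<le> \<epsilon> * dist (act s x) \<omega>"
      using \<eta> s(2) .
    also have "\<dots> = v s * (\<epsilon> * dist x \<omega>)"
      by (simp add: M.dist_act_centre)
    finally show ?thesis
      using s(1) by simp
  qed
  have "dist (h\<^sub>1 x) (h\<^sub>2 x) \<le> 0"
  \<comment> \<open>At the centre the bound is already 0; elsewhere, dividing \<open>e\<close> by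
    \<open>dist x \<omega>\<close> gives the \<epsilon> that turns the bound into
    \<open>e\<close>.\<close>
  proof (cases "x = \<omega>")
    case True
    then show ?thesis
      using bound[of 1] by simp
  next
    case False
    show ?thesis
    proof (rule field_le_epsilon)
      fix e :: real
      assume "0 < e"
      then show "dist (h\<^sub>1 x) (h\<^sub>2 x) \<le> 0 + e"
        using bound[of "e / dist x \<omega>"] False by simp
    qed
  qed
  then show "h\<^sub>1 x = h\<^sub>2 x"
    by simp
qed

end
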